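(* Let $n\ge5$ and let $A\in\mathfrak{F}_n$. Let $H$ be the subgroup of $W$ identified with the quotient $\mathrm{Aut}(S_A^n)/\mathbb{Z}_n^2$, i.e. the stabiliser of $A$ in $W$. Then $H$ is isomorphic to one of $\{\mathrm{Id}\}$, $\mathbb{Z}_2$, $\mathbb{Z}_3$, $\mathbb{Z}_6$ or $\mathcal{S}_3$.
   Context: Notation: $\mathbb{Z}_n=\mathbb{Z}/n\mathbb{Z}$ with unit group $U(\mathbb{Z}_n)$; $F_n=\{[x:y:z]\in\mathbb{P}^2(\mathbb{C}) : x^n+y^n+z^n=0\}$; $\xi=e^{2\pi i/n}$. For $A=\begin{pmatrix}a&b\\c&d\end{pmatrix}\in\mathrm{GL}_2(\mathbb{Z}_n)$, $G_A\cong\mathbb{Z}_n^2$ is the subgroup of $\mathrm{Aut}(F_n\times F_n)$ of all transformations $$\left([x_1:y_1:z_1],[x_2:y_2:z_2]\right)\mapsto\left([\xi^{\alpha}x_1:\xi^{\beta}y_1:z_1],[\xi^{a\alpha+b\beta}x_2:\xi^{c\alpha+d\beta}y_2:z_2]\right),\quad(\alpha,\beta)\in\mathbb{Z}_n^2.$$ $\mathfrak{F}_n$ is the set of $A=\begin{pmatrix}a&b\\c&d\end{pmatrix}\in\mathrm{GL}_2(\mathbb{Z}_n)$ with $a,b,c,d,a+b,c+d,a-c,b-d,a+b-c-d\in U(\mathbb{Z}_n)$; these are exactly the $A$ for which $G_A$ acts freely on $F_n\times F_n$. For $A\in\mathfrak{F}_n$, $S_A^n=(F_n\times F_n)/G_A$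 is the corresponding Beauville surface. The group $\mathbb{Z}_n^2\times\mathbb{Z}_n^2$ acts on $F_n\times F_n$, each factor $\mathbb{Z}_n^2$ acting on the corresponding curve by $(\alpha,\beta)[x:y:z]=[\xi^\alpha x:\xi^\beta y:z]$. $W=\mathrm{Aut}(F_n\times F_n)/(\mathbb{Z}_n^2\times\mathbb{Z}_n^2)\cong(\mathcal{S}_3\times\mathcal{S}_3)\rtimes\langle J\rangle$, where the $\mathcal{S}_3$'s permute homogeneous coordinates on the respective factors and $J(\mu_1,\mu_2)=(\mu_2,\mu_1)$. Let $M:\mathcal{S}_3\to\mathrm{GL}_2(\mathbb{Z}_n)$, $\tau\mapsto M_\tau$, be the monomorphism with $M_{(1,3,2)}=\begin{pmatrix}-1&1\\-1&0\end{pmatrix}$, $M_{(1,2)}=\begin{pmatrix}0&1\\1&0\end{pmatrix}$. Conjugation of the groups $G_A$ induces an action of $W$ on $\mathfrak{F}_n$: $(\tau_1,\tau_2)$ sends $A$ to $M_{\tau_2}AM_{\tau_1}^{-1}$ and $J$ sends $A$ to $A^{-1}$. Automorphisms of $S_A^n$ lift to $F_n\times F_n$, so $\mathrm{Aut}(S_A^n)\cong N(G_A)/G_A$, with $N(G_A)$ the normaliser of $G_A$ in $\mathrm{Aut}(F_n\times F_n)$. Here $G_A\le\mathbb{Z}_n^2\times\mathbb{Z}_n^2\le N(G_A)$, and the subgroup $\mathbb{Z}_n^2$ of $\mathrm{Aut}(S_A^n)$ is $(\mathbb{Z}_n^2\times\mathbb{Z}_n^2)/G_A$. Thus $\mathrm{Aut}(S_A^n)/\mathbb{Z}_n^2=N(G_A)/(\mathbb{Z}_n^2\times\mathbb{Z}_n^2)$,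 which is the stabiliser of $A$ in $W$. *)

theory Defs
  imports
    "HOL-Analysis.Analysis"
    "HOL-Algebra.Algebra"
    "Berlekamp_Zassenhaus.Finite_Field"
begin

text \<open>
  The ring \<open>\<int>/n\<int>\<close> is \<open>'n mod_ring\<close> with \<open>n = CARD('n)\<close>; the class \<open>nontriv\<close>
  only says \<open>n > 1\<close>.
\<close>

type_synonym 'n matZ = "'n mod_ring ^ 2 ^ 2"

definition mat2 :: "'a::zero \<Rightarrow> 'a \<Rightarrow> 'a \<Rightarrow> 'a \<Rightarrow> 'a ^ 2 ^ 2"
  where "mat2 a b c d = vector [vector [a, b], vector [c, d]]"

definition GL2 :: "('n::nontriv) matZ monoid"
  where "GL2 = \<lparr>carrier = {A. invertible A}, mult = (**), one = mat 1\<rparr>"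

definition frakF :: "('n::nontriv) matZ set"
  where "frakF = {A \<in> carrier GL2.
     let a = A $ 1 $ 1; b = A $ 1 $ 2; c = A $ 2 $ 1; d = A $ 2 $ 2
     in \<forall>u \<in> {a, b, c, d, a + b, c + d, a - c, b - d, a + b - c - d}. u dvd 1}"


text \<open>
  A permutation \<open>\<tau>\<close> moves the exponent vector \<open>(\<alpha>, \<beta>, 0)\<close> of the diagonal transformation
  \<open>[x : y : z] \<mapsto> [\<xi>\<^sup>\<alpha> x : \<xi>\<^sup>\<beta> y : z]\<close> so that its entry at position \<open>j\<close> goes to position \<open>\<tau> j\<close>;
  normalising the last exponent to 0 by subtraction gives the matrix \<open>permM \<tau>\<close> acting on
  \<open>(\<alpha>, \<beta>)\<close>. By the lemmas below it is the monomorphism determined by its values at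
  \<open>(1,3,2)\<close> and \<open>(1,2)\<close>.
\<close>

definition permM :: "(nat \<Rightarrow> nat) \<Rightarrow> ('n::nontriv) matZ"
  where "permM \<tau> = mat2
     (of_bool (\<tau> 1 = 1) - of_bool (\<tau> 1 = 3)) (of_bool (\<tau> 2 = 1) - of_bool (\<tau> 2 = 3))
     (of_bool (\<tau> 1 = 2) - of_bool (\<tau> 1 = 3)) (of_bool (\<tau> 2 = 2) - of_bool (\<tau> 2 = 3))"


definition semidirect_product ::
    "('a, 'c) monoid_scheme \<Rightarrow> ('b, 'd) monoid_scheme \<Rightarrow> ('b \<Rightarrow> 'a \<Rightarrow> 'a) \<Rightarrow> ('a \<times> 'b) monoid"
  where "semidirect_product N K \<theta> =
    \<lparr>carrier = carrier N \<times> carrier K,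
     mult = (\<lambda>(x, k) (y, l). (x \<otimes>\<^bsub>N\<^esub> \<theta> k y, k \<otimes>\<^bsub>K\<^esub> l)),
     one = (\<one>\<^bsub>N\<^esub>, \<one>\<^bsub>K\<^esub>)\<rparr>"

text \<open>
  \<open>W\<close> is the group of outer symmetries \<open>(S\<^sub>3 \<times> S\<^sub>3) \<rtimes> \<langle>J\<rangle>\<close> of \<open>F\<^sub>n \<times> F\<^sub>n\<close>. The element \<open>((\<tau>\<^sub>1, \<tau>\<^sub>2), k)\<close> stands for \<open>(\<tau>\<^sub>1, \<tau>\<^sub>2) J\<^sup>k\<close>, with \<open>J\<close> applied first.
  \<open>W_action\<close> describes conjugation of the groups
  \<open>G\<^sub>A = {(v, A v) | v \<in> (\<int>/n\<int>)\<^sup>2}\<close>; in particular \<open>J\<close> exchanges the two components and sends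
  \<open>A\<close> to its inverse. The two results \<open>group_W\<close> and \<open>group_action_W\<close> confirm that this is
  a group acting on \<open>frakF\<close>.
\<close>

definition W :: "(((nat \<Rightarrow> nat) \<times> (nat \<Rightarrow> nat)) \<times> int) monoid"
  where "W = semidirect_product (sym_group 3 \<times>\<times> sym_group 3) (integer_mod_group 2)
     (\<lambda>k. if k = 0 then id else prod.swap)"

definition W_action ::
    "((nat \<Rightarrow> nat) \<times> (nat \<Rightarrow> nat)) \<times> int \<Rightarrow> ('n::nontriv) matZ \<Rightarrow> 'n matZ"
  where "W_action = (\<lambda>((\<tau>\<^sub>1, \<tau>\<^sub>2), k). \<lambda>A \<in> frakF.
     permM \<tau>\<^sub>2 ** (if k = 0 then A else matrix_inv A) ** matrix_inv (permM \<tau>\<^sub>1))"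


lemma mat2_nth [simp]:
  "mat2 a b c d $ 1 $ 1 = a" "mat2 a b c d $ 1 $ 2 = b"
  "mat2 a b c d $ 2 $ 1 = c" "mat2 a b c d $ 2 $ 2 = d"
  by (simp_all add: mat2_def)

lemma mat2_eta: "A = mat2 (A $ 1 $ 1) (A $ 1 $ 2) (A $ 2 $ 1) (A $ 2 $ 2)"
  by (simp add: vec_eq_iff forall_2)

lemma mat2_eq_iff: "mat2 a b c d = mat2 a' b' c' d' \<longleftrightarrow> a = a' \<and> b = b' \<and> c = c' \<and> d = d'"
  by (metis mat2_nth)

lemma mat_1_mat2: "mat 1 = mat2 1 0 0 (1 :: 'a :: zero_neq_one)"
  by (simp add: vec_eq_iff forall_2 mat_def)

lemma mat2_mult:
  "mat2 a b c d ** mat2 a' b' c' d' =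
   mat2 (a * a' + b * c') (a * b' + b * d') (c * a' + d * c') (c * b' + d * d' :: 'a :: comm_semiring_1)"
  by (simp add: vec_eq_iff forall_2 matrix_matrix_mult_def sum_2)

lemma mat2_inverse:
  fixes a b c d u :: "'a :: comm_ring_1"
  assumes "(a * d - b * c) * u = 1"
  shows "mat2 a b c d ** mat2 (u * d) (- (u * b)) (- (u * c)) (u * a) = mat 1"
    and "mat2 (u * d) (- (u * b)) (- (u * c)) (u * a) ** mat2 a b c d = mat 1"
  using assms by (simp_all add: mat2_mult mat_1_mat2 mat2_eq_iff algebra_simps)

lemma matrix_inv_mult:
  assumes "invertible (A :: 'a :: comm_ring_1 ^ 2 ^ 2)"
  shows "A ** matrix_inv A = mat 1" "matrix_inv A ** A = mat 1"
proof -
  have "A ** matrix_inv A = mat 1 \<and> matrix_inv A ** A = mat 1"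
    using assms unfolding invertible_def matrix_inv_def by (rule someI_ex)
  then show "A ** matrix_inv A = mat 1" "matrix_inv A ** A = mat 1" by auto
qed

lemma matrix_inv_eqI:
  fixes A B :: "'a :: comm_ring_1 ^ 2 ^ 2"
  assumes "A ** B = mat 1" "B ** A = mat 1"
  shows "matrix_inv A = B"
proof -
  have "invertible A" using assms by (auto simp: invertible_def)
  have "B = B ** (A ** matrix_inv A)" using matrix_inv_mult(1)[OF \<open>invertible A\<close>] by simp
  also have "\<dots> = matrix_inv A" using assms(2) by (simp add: matrix_mul_assoc)
  finally show ?thesis by simp
qed

lemma invertible_matrix_inv:
  "invertible (A :: 'a :: comm_ring_1 ^ 2 ^ 2) \<Longrightarrow> invertible (matrix_inv A)"
  using matrix_inv_mult[of A] by (auto simp: invertible_def)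

lemma matrix_inv_matrix_inv:
  "invertible (A :: 'a :: comm_ring_1 ^ 2 ^ 2) \<Longrightarrow> matrix_inv (matrix_inv A) = A"
  by (intro matrix_inv_eqI matrix_inv_mult)

lemma matrix_inv_matrix_mul:
  fixes A B :: "'a :: comm_ring_1 ^ 2 ^ 2"
  assumes "invertible A" "invertible B"
  shows "matrix_inv (A ** B) = matrix_inv B ** matrix_inv A"
proof (rule matrix_inv_eqI)
  have "A ** B ** (matrix_inv B ** matrix_inv A) = A ** (B ** matrix_inv B) ** matrix_inv A"
    by (simp only: matrix_mul_assoc)
  then show "A ** B ** (matrix_inv B ** matrix_inv A) = mat 1"
    by (simp add: matrix_inv_mult assms)
  have "matrix_inv B ** matrix_inv A ** (A ** B) = matrix_inv B ** (matrix_inv A ** A) ** B"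
    by (simp only: matrix_mul_assoc)
  then show "matrix_inv B ** matrix_inv A ** (A ** B) = mat 1"
    by (simp add: matrix_inv_mult assms)
qed

lemma invertible_mat2_iff:
  fixes a b c d :: "'a :: comm_ring_1"
  shows "invertible (mat2 a b c d) \<longleftrightarrow> a * d - b * c dvd 1"
proof
  assume "a * d - b * c dvd 1"
  then obtain u where "(a * d - b * c) * u = 1" by (metis dvdE)
  from mat2_inverse[OF this] show "invertible (mat2 a b c d)" by (auto simp: invertible_def)
next
  assume "invertible (mat2 a b c d)"
  then obtain B where "mat2 a b c d ** B = mat 1" by (auto simp: invertible_def)
  then have "det (mat2 a b c d) * det B = 1" by (metis det_I det_mul)
  then show "a * d - b * c dvd 1" by (simp add: det_2 dvdI[of 1 _ "det B"])
qed

lemma group_GL2: "group (GL2 :: ('n::nontriv) matZ monoid)"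
proof (rule groupI)
  fix A :: "'n matZ" assume "A \<in> carrier GL2"
  then show "\<exists>B\<in>carrier GL2. B \<otimes>\<^bsub>GL2\<^esub> A = \<one>\<^bsub>GL2\<^esub>"
    by (intro bexI[of _ "matrix_inv A"]) (simp_all add: GL2_def matrix_inv_mult invertible_matrix_inv)
qed (simp_all add: GL2_def invertible_mult matrix_mul_assoc[symmetric] mat_1_mat2 invertible_mat2_iff,
     simp add: mat_1_mat2[symmetric])

lemma in_frakF_mat2:
  "mat2 a b c d \<in> (frakF :: ('n::nontriv) matZ set) \<longleftrightarrow>
     a * d - b * c dvd 1 \<and> a dvd 1 \<and> b dvd 1 \<and> c dvd 1 \<and> d dvd 1 \<and> a + b dvd 1 \<and>
     c + d dvd 1 \<and> a - c dvd 1 \<and> b - d dvd 1 \<and> a + b - c - d dvd 1"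
  by (simp add: frakF_def GL2_def Let_def invertible_mat2_iff)

lemma frakF_invertible: "A \<in> frakF \<Longrightarrow> invertible A"
  by (simp add: frakF_def GL2_def)

lemma permutes_3_cases:
  assumes "\<tau> permutes {1..3::nat}"
  shows "(\<tau> 1 = 1 \<and> \<tau> 2 = 2 \<and> \<tau> 3 = 3) \<or> (\<tau> 1 = 1 \<and> \<tau> 2 = 3 \<and> \<tau> 3 = 2) \<or>
         (\<tau> 1 = 2 \<and> \<tau> 2 = 1 \<and> \<tau> 3 = 3) \<or> (\<tau> 1 = 2 \<and> \<tau> 2 = 3 \<and> \<tau> 3 = 1) \<or>
         (\<tau> 1 = 3 \<and> \<tau> 2 = 1 \<and> \<tau> 3 = 2) \<or> (\<tau> 1 = 3 \<and> \<tau> 2 = 2 \<and> \<tau> 3 = (1::nat))"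
proof -
  have S: "{1..3} = {1, 2, 3::nat}" by auto
  have in1: "\<tau> 1 = 1 \<or> \<tau> 1 = 2 \<or> \<tau> 1 = 3" and in2: "\<tau> 2 = 1 \<or> \<tau> 2 = 2 \<or> \<tau> 2 = 3"
    and in3: "\<tau> 3 = 1 \<or> \<tau> 3 = 2 \<or> \<tau> 3 = 3"
    using permutes_in_image[OF assms] unfolding S by blast+
  have neq: "\<tau> 1 \<noteq> \<tau> 2" "\<tau> 1 \<noteq> \<tau> 3" "\<tau> 2 \<noteq> \<tau> 3"
    by (simp_all add: inj_eq[OF permutes_inj[OF assms]])
  from in1 show ?thesis
  proof (elim disjE)
    assume 1: "\<tau> 1 = 1" then show ?thesis using in2 in3 neq by presburger
  next
    assume 1: "\<tau> 1 = 2" then show ?thesis using in2 in3 neq by presburger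
  next
    assume 1: "\<tau> 1 = 3" then show ?thesis using in2 in3 neq by presburger
  qed
qed

lemma permM_comp:
  assumes "\<sigma> permutes {1..3}" "\<tau> permutes {1..3}"
  shows "(permM (\<sigma> \<circ> \<tau>) :: ('n::nontriv) matZ) = permM \<sigma> ** permM \<tau>"
  using permutes_3_cases[OF assms(1)] permutes_3_cases[OF assms(2)]
  by (elim disjE conjE) (simp_all add: permM_def mat2_mult mat2_eq_iff)

lemma permM_id: "permM id = mat 1"
  by (simp add: permM_def mat_1_mat2)

lemma permM_invertible:
  assumes "\<tau> permutes {1..3}" shows "invertible (permM \<tau> :: ('n::nontriv) matZ)"
  using permutes_3_cases[OF assms]
  by (elim disjE conjE) (simp_all add: permM_def invertible_mat2_iff)

lemma permM_hom: "permM \<in> hom (sym_group 3) (GL2 :: ('n::nontriv) matZ monoid)"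
  by (auto simp: hom_def sym_group_def GL2_def permM_comp permM_invertible)

lemma permM_inj: "inj_on (permM :: _ \<Rightarrow> ('n::nontriv) matZ) (carrier (sym_group 3))"
proof (rule inj_onI)
  fix \<sigma> \<tau> :: "nat \<Rightarrow> nat"
  assume "\<sigma> \<in> carrier (sym_group 3)" "\<tau> \<in> carrier (sym_group 3)"
    and eq: "(permM \<sigma> :: 'n matZ) = permM \<tau>"
  then have p: "\<sigma> permutes {1..3}" "\<tau> permutes {1..3}" by (auto simp: sym_group_def)
  have on: "\<sigma> 1 = \<tau> 1" "\<sigma> 2 = \<tau> 2" "\<sigma> 3 = \<tau> 3"
    using permutes_3_cases[OF p(1)] permutes_3_cases[OF p(2)] eq
    by (elim disjE conjE; simp add: permM_def mat2_eq_iff)+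
  show "\<sigma> = \<tau>"
  proof
    fix x :: nat
    consider "x = 1" | "x = 2" | "x = 3" | "x \<notin> {1..3}" unfolding atLeastAtMost_iff by linarith
    then show "\<sigma> x = \<tau> x" using on p by cases (auto simp: permutes_def)
  qed
qed

lemma permM_132: "(permM (cycle_of_list [1, 3, 2]) :: ('n::nontriv) matZ) = mat2 (- 1) 1 (- 1) 0"
  by (simp add: permM_def transpose_def)

lemma permM_12: "(permM (cycle_of_list [1, 2]) :: ('n::nontriv) matZ) = mat2 0 1 1 0"
  by (simp add: permM_def transpose_def)

lemma matrix_inv_permM:
  assumes "\<tau> permutes {1..3}"
  shows "matrix_inv (permM \<tau> :: ('n::nontriv) matZ) = permM (inv' \<tau>)"
  using permutes_inv[OF assms] permutes_inv_o[OF assms] assms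
  by (intro matrix_inv_eqI) (simp_all flip: permM_comp add: permM_id)

lemma unit_diff_swap: "(x - y :: 'a :: comm_ring_1) dvd 1 \<longleftrightarrow> y - x dvd 1"
  using minus_dvd_iff[of "x - y" 1] by simp

lemma frakF_units:
  assumes "mat2 a b c d \<in> (frakF :: ('n::nontriv) matZ set)"
  shows "a dvd 1" "b dvd 1" "c dvd 1" "d dvd 1" "a + b dvd 1" "c + d dvd 1"
    "a - c dvd 1" "c - a dvd 1" "b - d dvd 1" "d - b dvd 1" "a + b - (c + d) dvd 1"
    "c + d - (a + b) dvd 1" "- a - b dvd 1" "- c - d dvd 1"
  using assms unit_diff_swap[of a c] unit_diff_swap[of b d] unit_diff_swap[of "a + b" "c + d"]
    minus_dvd_iff[of "a + b" 1] minus_dvd_iff[of "c + d" 1]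
  by (simp_all add: in_frakF_mat2 diff_diff_eq add_ac)

lemma frakF_permM_left:
  assumes "\<tau> permutes {1..3}" "A \<in> (frakF :: ('n::nontriv) matZ set)"
  shows "permM \<tau> ** A \<in> frakF"
proof -
  obtain a b c d where A: "A = mat2 a b c d" using mat2_eta by blast
  note u = frakF_units[OF assms(2)[unfolded A]]
  have "invertible (permM \<tau> ** A)"
    by (rule invertible_mult[OF permM_invertible[OF assms(1)] frakF_invertible[OF assms(2)]])
  then show ?thesis
    using permutes_3_cases[OF assms(1)] u
    by (elim disjE conjE)
      (simp_all add: permM_def A mat2_mult in_frakF_mat2 invertible_mat2_iff algebra_simps)
qed

lemma frakF_permM_right:
  assumes "\<tau> permutes {1..3}" "A \<in> (frakF :: ('n::nontriv) matZ set)"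
  shows "A ** permM \<tau> \<in> frakF"
proof -
  obtain a b c d where A: "A = mat2 a b c d" using mat2_eta by blast
  note u = frakF_units[OF assms(2)[unfolded A]]
  have "invertible (A ** permM \<tau>)"
    by (rule invertible_mult[OF frakF_invertible[OF assms(2)] permM_invertible[OF assms(1)]])
  then show ?thesis
    using permutes_3_cases[OF assms(1)] u
    by (elim disjE conjE)
      (simp_all add: permM_def A mat2_mult in_frakF_mat2 invertible_mat2_iff algebra_simps)
qed

lemma frakF_matrix_inv:
  assumes "A \<in> (frakF :: ('n::nontriv) matZ set)"
  shows "matrix_inv A \<in> frakF"
proof -
  obtain a b c d where A: "A = mat2 a b c d" using mat2_eta by blast
  note u = frakF_units[OF assms[unfolded A]]
  have "a * d - b * c dvd 1" using assms by (simp add: A in_frakF_mat2)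
  then obtain v where v: "(a * d - b * c) * v = 1" by (metis dvdE)
  have inv: "matrix_inv A = mat2 (v * d) (- (v * b)) (- (v * c)) (v * a)"
    unfolding A by (intro matrix_inv_eqI mat2_inverse[OF v])
  have m: "v * x dvd 1" if "x dvd 1" for x
    using that v by (metis dvd_triv_right mult_dvd_mono mult_1)
  have "invertible (matrix_inv A)" using assms frakF_invertible invertible_matrix_inv by blast
  then have "v * d * (v * a) - v * b * (v * c) dvd 1" by (simp add: inv invertible_mat2_iff)
  moreover have "v * d - v * b dvd 1" "v * a - v * c dvd 1" "v * d + v * c dvd 1"
    "v * a + v * b dvd 1" "v * d + v * c - (v * a + v * b) dvd 1"
    using m[of "d - b"] m[of "a - c"] m[of "c + d"] m[of "a + b"] m[of "c + d - (a + b)"] u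
    by (simp_all add: algebra_simps)
  moreover have "- (v * b) - v * a dvd 1"
  proof -
    have "v * (- a - b) = - (v * a) - v * b" by (simp add: right_diff_distrib)
    also have "\<dots> = - (v * b) - v * a" by (rule minus_diff_commute)
    finally show ?thesis using m[of "- a - b"] u by simp
  qed
  ultimately show ?thesis
    using u m unit_diff_swap[of "v * a" "v * c"] minus_dvd_iff[of "v * a + v * b" 1]
    by (simp add: inv in_frakF_mat2 algebra_simps)
qed

lemma W_carrier_iff:
  "((\<tau>\<^sub>1, \<tau>\<^sub>2), k) \<in> carrier W \<longleftrightarrow> \<tau>\<^sub>1 permutes {1..3} \<and> \<tau>\<^sub>2 permutes {1..3} \<and> (k = 0 \<or> k = 1)"
proof -
  have "k \<in> {0..<2} \<longleftrightarrow> k = 0 \<or> k = 1" by (simp only: atLeastLessThan_iff) presburger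
  then show ?thesis
    by (simp add: W_def semidirect_product_def sym_group_def carrier_integer_mod_group
        del: atLeastLessThan_iff)
qed

lemma W_mult:
  "((\<sigma>\<^sub>1, \<sigma>\<^sub>2), k) \<otimes>\<^bsub>W\<^esub> ((\<tau>\<^sub>1, \<tau>\<^sub>2), l) =
     (if k = 0 then (\<sigma>\<^sub>1 \<circ> \<tau>\<^sub>1, \<sigma>\<^sub>2 \<circ> \<tau>\<^sub>2) else (\<sigma>\<^sub>1 \<circ> \<tau>\<^sub>2, \<sigma>\<^sub>2 \<circ> \<tau>\<^sub>1), (k + l) mod 2)"
  by (simp add: W_def semidirect_product_def sym_group_def)

lemma W_one: "\<one>\<^bsub>W\<^esub> = ((id, id), 0)"
  by (simp add: W_def semidirect_product_def sym_group_def)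

lemma group_W: "group W"
proof (rule groupI)
  fix x assume "x \<in> carrier W"
  moreover obtain \<sigma> \<tau> k where x: "x = ((\<sigma>, \<tau>), k)" by (metis surj_pair)
  ultimately have p: "\<sigma> permutes {1..3}" "\<tau> permutes {1..3}" and k: "k = 0 \<or> k = 1"
    by (auto simp: W_carrier_iff)
  let ?y = "(if k = 0 then (inv' \<sigma>, inv' \<tau>) else (inv' \<tau>, inv' \<sigma>), k)"
  have "?y \<in> carrier W" "?y \<otimes>\<^bsub>W\<^esub> x = \<one>\<^bsub>W\<^esub>"
    using p k by (auto simp: x W_carrier_iff W_mult W_one permutes_inv permutes_inv_o)
  then show "\<exists>y\<in>carrier W. y \<otimes>\<^bsub>W\<^esub> x = \<one>\<^bsub>W\<^esub>" by blast
next
  fix x y assume "x \<in> carrier W" "y \<in> carrier W"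
  then show "x \<otimes>\<^bsub>W\<^esub> y \<in> carrier W"
    by (cases x rule: prod.exhaust, cases y rule: prod.exhaust, cases "fst x", cases "fst y")
      (auto simp: W_carrier_iff W_mult permutes_compose)
next
  fix x y z assume xyz: "x \<in> carrier W" "y \<in> carrier W" "z \<in> carrier W"
  obtain a b k where x: "x = ((a, b), k)" by (metis surj_pair)
  obtain c d l where y: "y = ((c, d), l)" by (metis surj_pair)
  obtain e f m where z: "z = ((e, f), m)" by (metis surj_pair)
  have k: "k = 0 \<or> k = 1" "l = 0 \<or> l = 1" using xyz by (simp_all add: x y W_carrier_iff)
  show "x \<otimes>\<^bsub>W\<^esub> y \<otimes>\<^bsub>W\<^esub> z = x \<otimes>\<^bsub>W\<^esub> (y \<otimes>\<^bsub>W\<^esub> z)"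
    using k by (elim disjE) (simp_all add: x y z W_mult comp_assoc mod_simps)
next
  show "\<one>\<^bsub>W\<^esub> \<in> carrier W" by (simp add: W_one W_carrier_iff permutes_id)
next
  fix x assume "x \<in> carrier W"
  then show "\<one>\<^bsub>W\<^esub> \<otimes>\<^bsub>W\<^esub> x = x"
    by (cases x rule: prod.exhaust, cases "fst x") (auto simp: W_carrier_iff W_mult W_one)
qed

lemma W_action_closed:
  assumes "w \<in> carrier W" "A \<in> frakF" shows "W_action w A \<in> frakF"
proof -
  obtain \<sigma> \<tau> k where w: "w = ((\<sigma>, \<tau>), k)" by (metis surj_pair)
  then show ?thesis
    using assms
    by (simp add: W_action_def W_carrier_iff matrix_inv_permM permutes_inv frakF_permM_left
        frakF_permM_right frakF_matrix_inv)
qed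

lemma W_action_mult:
  assumes "v \<in> carrier W" "w \<in> carrier W" "A \<in> (frakF :: ('n::nontriv) matZ set)"
  shows "W_action (v \<otimes>\<^bsub>W\<^esub> w) A = W_action v (W_action w A)"
proof -
  obtain \<sigma>\<^sub>1 \<sigma>\<^sub>2 k where v: "v = ((\<sigma>\<^sub>1, \<sigma>\<^sub>2), k)" by (metis surj_pair)
  obtain \<tau>\<^sub>1 \<tau>\<^sub>2 l where w: "w = ((\<tau>\<^sub>1, \<tau>\<^sub>2), l)" by (metis surj_pair)
  have p: "\<sigma>\<^sub>1 permutes {1..3}" "\<sigma>\<^sub>2 permutes {1..3}" "\<tau>\<^sub>1 permutes {1..3}" "\<tau>\<^sub>2 permutes {1..3}"
    and kl: "k = 0 \<or> k = 1" "l = 0 \<or> l = 1"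
    using assms by (auto simp: v w W_carrier_iff)
  have wA: "W_action w A \<in> frakF" using assms W_action_closed by blast
  have iv: "invertible A" "invertible (matrix_inv A)"
    using assms(3) by (simp_all add: frakF_invertible invertible_matrix_inv)
  have pi: "invertible (permM \<tau>\<^sub>1 :: 'n matZ)" "invertible (permM \<tau>\<^sub>2 :: 'n matZ)"
    using p by (auto intro: permM_invertible)
  have 1: "W_action v (W_action w A) = permM \<sigma>\<^sub>2 **
      (if k = 0 then W_action w A else matrix_inv (W_action w A)) ** matrix_inv (permM \<sigma>\<^sub>1)"
    using wA by (simp add: v W_action_def)
  have 2: "W_action w A =
      permM \<tau>\<^sub>2 ** (if l = 0 then A else matrix_inv A) ** matrix_inv (permM \<tau>\<^sub>1)"
    using assms(3) by (simp add: w W_action_def)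
  have 3: "W_action (v \<otimes>\<^bsub>W\<^esub> w) A =
      (if k = 0 then permM \<sigma>\<^sub>2 ** permM \<tau>\<^sub>2 else permM \<sigma>\<^sub>2 ** permM \<tau>\<^sub>1) **
      (if (k + l) mod 2 = 0 then A else matrix_inv A) **
      (if k = 0 then matrix_inv (permM \<tau>\<^sub>1) ** matrix_inv (permM \<sigma>\<^sub>1)
       else matrix_inv (permM \<tau>\<^sub>2) ** matrix_inv (permM \<sigma>\<^sub>1))"
    using assms(3) p
    by (simp add: v w W_mult W_action_def permM_comp matrix_inv_matrix_mul permM_invertible)
  have 4: "matrix_inv (permM \<tau>\<^sub>2 ** B ** matrix_inv (permM \<tau>\<^sub>1)) =
      permM \<tau>\<^sub>1 ** matrix_inv B ** matrix_inv (permM \<tau>\<^sub>2)"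
    if "invertible B" for B :: "'n matZ"
    using matrix_inv_matrix_mul[OF invertible_mult[OF pi(2) that] invertible_matrix_inv[OF pi(1)]]
      matrix_inv_matrix_mul[OF pi(2) that] matrix_inv_matrix_inv[OF pi(1)]
    by (simp add: matrix_mul_assoc)
  show ?thesis
    unfolding 1 3 unfolding 2 using kl iv
    by (elim disjE) (simp_all add: 4 matrix_inv_matrix_inv matrix_mul_assoc)
qed

lemma W_action_one: "A \<in> frakF \<Longrightarrow> W_action \<one>\<^bsub>W\<^esub> A = A"
  by (simp add: W_action_def W_one permM_id matrix_inv_eqI[of "mat 1" "mat 1"])

lemma group_action_W: "group_action W (frakF :: ('n::nontriv) matZ set) W_action"
proof -
  interpret W: group W by (rule group_W)
  have bij: "W_action w \<in> Bij (frakF :: 'n matZ set)" if w: "w \<in> carrier W" for w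
  proof -
    have "bij_betw (W_action w) (frakF :: 'n matZ set) frakF"
    proof (rule bij_betw_byWitness[where f' = "W_action (inv\<^bsub>W\<^esub> w)"])
      show "\<forall>A\<in>frakF. W_action (inv\<^bsub>W\<^esub> w) (W_action w A) = (A :: 'n matZ)"
        "\<forall>A\<in>frakF. W_action w (W_action (inv\<^bsub>W\<^esub> w) A) = (A :: 'n matZ)"
        using w by (simp_all flip: W_action_mult add: W_action_one)
    qed (use w in \<open>auto intro!: W_action_closed\<close>)
    moreover have "W_action w \<in> extensional (frakF :: 'n matZ set)"
      by (simp add: W_action_def case_prod_unfold)
    ultimately show ?thesis by (simp add: Bij_def)
  qed
  have "W_action \<in> hom W (BijGroup (frakF :: 'n matZ set))"
  proof (rule homI)
    fix v w assume vw: "v \<in> carrier W" "w \<in> carrier W"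
    have "W_action (v \<otimes>\<^bsub>W\<^esub> w) = compose (frakF :: 'n matZ set) (W_action v) (W_action w)"
      using vw bij[of "v \<otimes>\<^bsub>W\<^esub> w"]
      by (intro extensionalityI[of _ frakF]) (auto simp: Bij_def compose_def W_action_mult)
    then show "W_action (v \<otimes>\<^bsub>W\<^esub> w) = W_action v \<otimes>\<^bsub>BijGroup (frakF :: 'n matZ set)\<^esub> W_action w"
      using vw bij by (simp add: BijGroup_def)
  qed (use bij in \<open>simp add: BijGroup_def\<close>)
  then show ?thesis
    by (simp add: group_action_def group_hom_def group_hom_axioms_def group_W group_BijGroup)
qed

end

theory Submission
  imports Defs
begin

text \<open>
  If \<open>(\<tau>\<^sub>1, \<tau>\<^sub>2)\<close> stabilises \<open>A\<close>, then \<open>A\<close> intertwines \<open>M\<^bsub>\<tau>\<^sub>1\<^esub>\<close> and \<open>M\<^bsub>\<tau>\<^sub>2\<^esub>\<close>, so \<open>\<tau>\<^sub>1\<close> and \<open>\<tau>\<^sub>2\<close>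
  determine each other. The unit conditions on \<open>A\<close> rule out that they are transpositions, hence
  the part of the stabiliser inside \<open>S\<^sub>3 \<times> S\<^sub>3\<close> embeds into the rotation subgroup of \<open>S\<^sub>3\<close> and has
  order 1 or 3. As its index in the stabiliser is at most 2, the stabiliser has order 1, 2, 3 or 6,
  and the listed groups are all groups of these orders.
\<close>

section \<open>Comparison of groups by parametrisations; groups of prime order\<close>

text \<open>Sending \<open>g p\<close> to \<open>h p\<close> is well defined by one direction of
  \<open>eq\<close> and injective by the other; the common product \<open>m\<close> on parameters
  makes it a homomorphism. Parameters may be redundant, so exponents can range over all naturals
  without being reduced.\<close>

lemma is_iso_by_parametrisation:
  fixes g :: "'p \<Rightarrow> 'a" and h :: "'p \<Rightarrow> 'b"
  assumes "range g = carrier G" "range h = carrier H"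
    and eq: "\<And>p q. g p = g q \<longleftrightarrow> h p = h q"
    and g: "\<And>p q. g p \<otimes>\<^bsub>G\<^esub> g q = g (m p q)"
    and h: "\<And>p q. h p \<otimes>\<^bsub>H\<^esub> h q = h (m p q)"
  shows "G \<cong> H"
proof -
  \<comment> \<open>\<open>inv' g\<close> picks an arbitrary parameter of each element;
    \<open>eq\<close> makes the value of \<open>h\<close> independent of the choice.\<close>
  define f where "f = h \<circ> inv' g"
  have f: "f (g p) = h p" for p
  proof -
    have "g (inv' g (g p)) = g p" by (simp add: f_inv_into_f)
    then show ?thesis by (simp add: f_def eq)
  qed
  have "f \<in> hom G H"
    unfolding assms(1)[symmetric] assms(2)[symmetric] hom_def by (auto simp: f g h)
  moreover have "bij_betw f (carrier G) (carrier H)"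
    unfolding assms(1)[symmetric] assms(2)[symmetric]
    by (auto simp: bij_betw_def inj_on_def f eq image_iff)
  ultimately show ?thesis
    by (intro is_isoI isoI)
qed

context group
begin

lemma nat_pow_eq_iff_cong:
  assumes "x \<in> carrier G"
  shows "x [^] (i::nat) = x [^] (j::nat) \<longleftrightarrow> [i = j] (mod ord x)"
  using int_pow_eq[OF assms, of "int i" "int j"]
  by (simp add: int_pow_int cong_sym_eq[of "int i"] flip: cong_int_iff cong_iff_dvd_diff)

lemma iso_integer_mod_group:
  assumes x: "x \<in> carrier G" and ord: "ord x = order G" and fin: "finite (carrier G)"
  shows "G \<cong> integer_mod_group (order G)"
proof (rule is_iso_by_parametrisation[where m = "(+)"])
  have n: "order G > 0" using fin order_gt_0_iff_finite by blast
  have inj: "inj_on (\<lambda>i::nat. x [^] i) {..<order G}"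
    by (auto simp: inj_on_def nat_pow_eq_iff_cong x ord cong_less_modulus_unique_nat)
  \<comment> \<open>The powers with exponent below the order of the group are distinct, so by
    counting they are all of \<open>G\<close>.\<close>
  have "(\<lambda>i::nat. x [^] i) ` {..<order G} = carrier G"
    using x card_image[OF inj] by (intro card_subset_eq fin) (auto simp: order_def)
  then show "range (\<lambda>i::nat. x [^] i) = carrier G"
    using x by auto
  show "range (\<lambda>i. int i mod int (order G)) = carrier (integer_mod_group (order G))"
  proof (intro equalityI subsetI)
    fix k assume "k \<in> carrier (integer_mod_group (order G))"
    then have "k = int (nat k) mod int (order G)"
      using n by (auto simp: carrier_integer_mod_group split: if_splits)
    then show "k \<in> range (\<lambda>i. int i mod int (order G))" by blast
  qed (use n in \<open>auto simp: carrier_integer_mod_group\<close>)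
  show "x [^] i = x [^] j \<longleftrightarrow> int i mod int (order G) = int j mod int (order G)" for i j :: nat
    by (simp add: nat_pow_eq_iff_cong x ord cong_def flip: of_nat_mod)
qed (simp_all add: nat_pow_mult x mod_add_eq)

text \<open>Cauchy's theorem: any non-identity element of a subgroup of order p has order dividing p
  and different from 1.\<close>

lemma exists_ord_eq_prime:
  assumes "finite (carrier G)" "Factorial_Ring.prime p" "p dvd order G"
  obtains x where "x \<in> carrier G" "ord x = p"
proof -
  \<comment> \<open>The exponent 1 asks Sylow's theorem for a subgroup of order exactly p; the
    cofactor m may still be divisible by p.\<close>
  obtain m where "order G = p ^ 1 * m" using assms(3) by (auto simp: dvd_def)
  from sylow_thm[OF assms(2) is_group this assms(1)]
  obtain K where K: "subgroup K G" "card K = p" by auto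
  interpret K: group "G\<lparr>carrier := K\<rparr>" using K by (simp add: subgroup_imp_group)
  have "p \<noteq> 1" using assms by auto
  then have "K \<noteq> {\<one>}" using K by auto
  moreover have "\<one> \<in> K" using K subgroup.one_closed by blast
  ultimately obtain x where x: "x \<in> K" "x \<noteq> \<one>" by blast
  then have xG: "x \<in> carrier G" using subgroup.mem_carrier[OF K(1)] by simp
  have "x [^] p = \<one>"
    using K.pow_order_eq_1[of x] x K by (simp add: order_def flip: nat_pow_consistent)
  then have "ord x dvd p" using xG pow_eq_id by blast
  moreover have "ord x \<noteq> 1" using xG x ord_eq_1 by blast
  ultimately have "ord x = p" using assms(2) prime_nat_iff by blast
  with xG show ?thesis by (rule that)
qed

lemma iso_integer_mod_group_of_prime_order:
  assumes "Factorial_Ring.prime (order G)"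
  shows "G \<cong> integer_mod_group (order G)"
proof -
  have fin: "finite (carrier G)" using prime_gt_0_nat[OF assms] by (simp add: order_gt_0_iff_finite)
  obtain x where "x \<in> carrier G" "ord x = order G" using exists_ord_eq_prime[OF fin assms dvd_refl] .
  then show ?thesis using fin by (rule iso_integer_mod_group)
qed

section \<open>Groups of order 6\<close>

text \<open>Each \<open>y\<close> that moves past a power of \<open>x\<close> multiplies the
  exponent by \<open>r\<close>, so \<open>j\<close> of them contribute \<open>r ^ j\<close>.\<close>

lemma pow_commute_shift:
  assumes xy: "x \<in> carrier G" "y \<in> carrier G" and rel: "y \<otimes> x = x [^] (r::nat) \<otimes> y"
  shows "y [^] (j::nat) \<otimes> x [^] (k::nat) = x [^] (r ^ j * k) \<otimes> y [^] j"
proof -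
  have step: "y \<otimes> x [^] k = x [^] (r * k) \<otimes> y" for k :: nat
  proof (induction k)
    case (Suc k)
    have "y \<otimes> x [^] Suc k = x [^] (r * k) \<otimes> (y \<otimes> x)"
      using xy Suc by (simp add: m_assoc[symmetric])
    also have "\<dots> = x [^] (r * k) \<otimes> x [^] r \<otimes> y"
      using xy by (simp add: rel m_assoc)
    finally show ?case using xy by (simp add: nat_pow_mult add.commute)
  qed (use xy in simp)
  show ?thesis
  proof (induction j arbitrary: k)
    case (Suc j)
    have "y [^] Suc j \<otimes> x [^] k = y [^] j \<otimes> (y \<otimes> x [^] k)"
      using xy by (simp add: m_assoc)
    also have "\<dots> = y [^] j \<otimes> x [^] (r * k) \<otimes> y"
      using xy by (simp add: step m_assoc)
    also have "\<dots> = x [^] (r ^ Suc j * k) \<otimes> y [^] Suc j"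
      using xy by (simp add: Suc m_assoc mult.assoc mult.left_commute)
    finally show ?case .
  qed (use xy in simp)
qed

text \<open>The resulting rule on exponents involves no data of the group except \<open>r\<close>;
  it serves as the common product in \<open>is_iso_by_parametrisation\<close>.\<close>

lemma normal_form_mult:
  assumes "x \<in> carrier G" "y \<in> carrier G" "y \<otimes> x = x [^] (r::nat) \<otimes> y"
  shows "(x [^] (i::nat) \<otimes> y [^] (j::nat)) \<otimes> (x [^] (k::nat) \<otimes> y [^] (l::nat)) =
    x [^] (i + r ^ j * k) \<otimes> y [^] (j + l)"
proof -
  have "(x [^] i \<otimes> y [^] j) \<otimes> (x [^] k \<otimes> y [^] l) = x [^] i \<otimes> (y [^] j \<otimes> x [^] k) \<otimes> y [^] l"
    using assms by (simp add: m_assoc)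
  then show ?thesis
    using assms by (simp add: pow_commute_shift[OF assms] m_assoc flip: nat_pow_mult)
qed

text \<open>As 2 does not divide 3, \<open>y\<close> is not a power of \<open>x\<close>. Hence the
  six products with exponents below 3 and 2 are distinct and exhaust the group.\<close>

lemma order_6_normal_form:
  assumes G: "order G = 6"
    and xy: "x \<in> carrier G" "y \<in> carrier G" and ord: "ord x = 3" "ord y = 2"
  shows "x [^] (i::nat) \<otimes> y [^] (j::nat) = x [^] (k::nat) \<otimes> y [^] (l::nat) \<longleftrightarrow>
           [i = k] (mod 3) \<and> [j = l] (mod 2)" (is ?eq)
    and "range (\<lambda>(i::nat, j::nat). x [^] i \<otimes> y [^] j) = carrier G"
proof -
  have y_not: "y \<noteq> x [^] (s::nat)" for s
  proof
    assume y: "y = x [^] s"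
    have "y [^] (3::nat) = \<one>"
      using xy ord by (simp add: y nat_pow_pow pow_eq_id)
    then show False using xy ord by (simp add: pow_eq_id)
  qed
  have yj: "y [^] j = y [^] (j mod 2)" for j :: nat
    using xy ord by (simp add: nat_pow_eq_iff_cong)
  \<comment> \<open>Multiplying by \<open>x [^] (2 * k)\<close> turns the right side into
    \<open>x [^] (3 * k)\<close> times \<open>y\<close>, which is \<open>y\<close>, so
    \<open>y\<close> would be a power of \<open>x\<close>.\<close>
  have no: "x [^] i \<noteq> x [^] k \<otimes> y" for i k :: nat
  proof
    assume "x [^] i = x [^] k \<otimes> y"
    then have "x [^] (2 * k + i) = x [^] (2 * k) \<otimes> x [^] k \<otimes> y"
      using xy by (simp add: m_assoc flip: nat_pow_mult)
    also have "\<dots> = y"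
      using xy ord pow_eq_id[of x "3 * k"] by (simp add: nat_pow_mult)
    finally show False using y_not by metis
  qed
  \<comment> \<open>By \<open>yj\<close> the exponents of \<open>y\<close> may be taken as 0 or 1.
    Equal parities reduce to powers of \<open>x\<close>; mixed parities are excluded by
    \<open>no\<close>.\<close>
  have inj: "x [^] i \<otimes> y [^] j = x [^] k \<otimes> y [^] l \<longleftrightarrow> [i = k] (mod 3) \<and> [j = l] (mod 2)"
    for i j k l :: nat
    using xy ord no[of i k] no[of k i, symmetric]
    by (subst (1 2) yj) (cases "even j"; cases "even l";
      simp add: cong_def even_iff_mod_2_eq_zero odd_iff_mod_2_eq_one nat_pow_eq_iff_cong)
  then show ?eq .
  have fin: "finite (carrier G)" using G order_gt_0_iff_finite by fastforce
  have inj_on: "inj_on (\<lambda>(i::nat, j::nat). x [^] i \<otimes> y [^] j) ({..<3} \<times> {..<2})"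
    by (auto simp: inj_on_def inj cong_less_modulus_unique_nat)
  have "(\<lambda>(i::nat, j::nat). x [^] i \<otimes> y [^] j) ` ({..<3} \<times> {..<2}) = carrier G"
    using xy G by (intro card_subset_eq fin) (auto simp: card_image[OF inj_on] order_def)
  then show "range (\<lambda>(i::nat, j::nat). x [^] i \<otimes> y [^] j) = carrier G"
    using xy by auto
qed

text \<open>Cauchy's theorem supplies \<open>x\<close> and \<open>y\<close>, and the normal form of
  the product of \<open>y\<close> and \<open>x\<close> supplies the relation. Only the exponents 1
  and 2 survive, and the value 1 means that the generators commute.\<close>

lemma order_6_presentation:
  assumes G: "order G = 6"
  obtains x y r where "x \<in> carrier G" "y \<in> carrier G" "ord x = 3" "ord y = 2"
    "y \<otimes> x = x [^] r \<otimes> y" "r = (if comm_group G then 1 else (2::nat))"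
proof -
  have fin: "finite (carrier G)" using G order_gt_0_iff_finite by fastforce
  obtain x where x: "x \<in> carrier G" "ord x = 3" using exists_ord_eq_prime[OF fin, of 3] G by auto
  obtain y where y: "y \<in> carrier G" "ord y = 2" using exists_ord_eq_prime[OF fin, of 2] G by auto
  note nf = order_6_normal_form[OF G x(1) y(1) x(2) y(2)]
  have "y \<otimes> x \<in> range (\<lambda>(i::nat, j::nat). x [^] i \<otimes> y [^] j)"
    using x y nf(2) by simp
  then obtain i j :: nat where yx: "y \<otimes> x = x [^] i \<otimes> y [^] j" by auto
  \<comment> \<open>Otherwise \<open>y\<close> is a power of \<open>x\<close>, namely
    \<open>x [^] (i + 2)\<close>, since the inverse of \<open>x\<close> is its square.\<close>
  have "\<not> [j = 0] (mod 2)"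
  proof
    assume "[j = 0] (mod 2)"
    then have "y [^] j = \<one>" using y by (simp add: pow_eq_id cong_0_iff)
    then have "y \<otimes> x = x [^] i" using yx x y by simp
    then have "y = x [^] i \<otimes> inv x" using x y by (metis inv_solve_right m_closed nat_pow_closed)
    also have "inv x = x [^] (2::nat)"
      using x pow_ord_eq_1[of x] by (intro inv_equality) (auto simp: numeral_3_eq_3 numeral_2_eq_2 m_assoc)
    finally show False
      using nf(1)[of 0 1 "i + 2" 0] x y by (simp add: nat_pow_mult cong_def)
  qed
  then have yj: "y [^] j = y"
    using y nat_pow_eq_iff_cong[of y j 1] by (simp add: cong_def mod_2_eq_odd)
  \<comment> \<open>Otherwise \<open>y\<close> cancels and \<open>x\<close> is trivial.\<close>
  have "\<not> [i = 0] (mod 3)"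
  proof
    assume "[i = 0] (mod 3)"
    then have "x [^] i = \<one>" using x by (simp add: pow_eq_id cong_0_iff)
    then have "x = \<one>" using yx yj x y by simp
    then show False using x by simp
  qed
  then have "i mod 3 = 1 \<or> i mod 3 = 2" by (simp add: cong_def) presburger
  moreover have "x [^] i = x [^] (i mod 3)" using x by (simp add: nat_pow_eq_iff_cong)
  ultimately have "\<exists>r\<in>{1, 2::nat}. y \<otimes> x = x [^] r \<otimes> y"
    using yx yj by (metis insertCI)
  then obtain r :: nat where r: "r \<in> {1, 2}" "y \<otimes> x = x [^] r \<otimes> y" by blast
  have "comm_group G \<longleftrightarrow> r = 1"
  proof
    assume "comm_group G"
    then have "x [^] r \<otimes> y = x [^] (1::nat) \<otimes> y"
      using r x y comm_group_def comm_monoid.m_comm by fastforce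
    then have "[r = 1] (mod 3)" using nf(1)[of r 1 1 1] x y by simp
    with r show "r = 1" by (auto simp: cong_def)
  next
    assume "r = 1"
    show "comm_group G"
    proof (rule group_comm_groupI)
      fix a b assume "a \<in> carrier G" "b \<in> carrier G"
      then obtain i j k l :: nat where "a = x [^] i \<otimes> y [^] j" "b = x [^] k \<otimes> y [^] l"
        unfolding nf(2)[symmetric] by auto
      then show "a \<otimes> b = b \<otimes> a"
        by (simp add: normal_form_mult[OF x(1) y(1) r(2)] \<open>r = 1\<close> add.commute)
    qed
  qed
  with x y r that show ?thesis by auto
qed

end

text \<open>Commutativity fixes the exponent \<open>r\<close> of the relation, and \<open>r\<close>
  fixes the multiplication of normal forms.\<close>

lemma order_6_iso:
  assumes "group G" "group H" "order G = 6" "order H = 6"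
    and comm: "comm_group G \<longleftrightarrow> comm_group H"
  shows "G \<cong> H"
proof -
  interpret G: group G by fact
  interpret H: group H by fact
  obtain x y r where x: "x \<in> carrier G" "y \<in> carrier G" "G.ord x = 3" "G.ord y = 2"
      "y \<otimes>\<^bsub>G\<^esub> x = x [^]\<^bsub>G\<^esub> r \<otimes>\<^bsub>G\<^esub> y"
    and r: "r = (if comm_group G then 1 else (2::nat))"
    by (rule G.order_6_presentation[OF assms(3)])
  obtain u v s where u: "u \<in> carrier H" "v \<in> carrier H" "H.ord u = 3" "H.ord v = 2"
      "v \<otimes>\<^bsub>H\<^esub> u = u [^]\<^bsub>H\<^esub> s \<otimes>\<^bsub>H\<^esub> v"
    and s: "s = (if comm_group H then 1 else (2::nat))"
    by (rule H.order_6_presentation[OF assms(4)])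
  have "s = r" using comm r s by simp
  note u = u[unfolded this]
  show ?thesis
  proof (rule is_iso_by_parametrisation)
    show "range (\<lambda>(i::nat, j::nat). x [^]\<^bsub>G\<^esub> i \<otimes>\<^bsub>G\<^esub> y [^]\<^bsub>G\<^esub> j) = carrier G"
      by (rule G.order_6_normal_form(2)[OF assms(3) x(1-4)])
    show "range (\<lambda>(i::nat, j::nat). u [^]\<^bsub>H\<^esub> i \<otimes>\<^bsub>H\<^esub> v [^]\<^bsub>H\<^esub> j) = carrier H"
      by (rule H.order_6_normal_form(2)[OF assms(4) u(1-4)])
    show "(case p of (i::nat, j::nat) \<Rightarrow> x [^]\<^bsub>G\<^esub> i \<otimes>\<^bsub>G\<^esub> y [^]\<^bsub>G\<^esub> j) =
        (case q of (i::nat, j::nat) \<Rightarrow> x [^]\<^bsub>G\<^esub> i \<otimes>\<^bsub>G\<^esub> y [^]\<^bsub>G\<^esub> j) \<longleftrightarrow>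
      (case p of (i::nat, j::nat) \<Rightarrow> u [^]\<^bsub>H\<^esub> i \<otimes>\<^bsub>H\<^esub> v [^]\<^bsub>H\<^esub> j) =
        (case q of (i::nat, j::nat) \<Rightarrow> u [^]\<^bsub>H\<^esub> i \<otimes>\<^bsub>H\<^esub> v [^]\<^bsub>H\<^esub> j)" for p q
      by (simp add: split_beta G.order_6_normal_form(1)[OF assms(3) x(1-4)]
        H.order_6_normal_form(1)[OF assms(4) u(1-4)])
    let ?m = "\<lambda>(i, j) (k, l). (i + r ^ j * k, j + l)"
    show "(case p of (i::nat, j::nat) \<Rightarrow> x [^]\<^bsub>G\<^esub> i \<otimes>\<^bsub>G\<^esub> y [^]\<^bsub>G\<^esub> j) \<otimes>\<^bsub>G\<^esub>
        (case q of (i::nat, j::nat) \<Rightarrow> x [^]\<^bsub>G\<^esub> i \<otimes>\<^bsub>G\<^esub> y [^]\<^bsub>G\<^esub> j) =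
      (case ?m p q of (i::nat, j::nat) \<Rightarrow> x [^]\<^bsub>G\<^esub> i \<otimes>\<^bsub>G\<^esub> y [^]\<^bsub>G\<^esub> j)" for p q
      using G.normal_form_mult[OF x(1,2,5)] by (simp add: split_beta)
    show "(case p of (i::nat, j::nat) \<Rightarrow> u [^]\<^bsub>H\<^esub> i \<otimes>\<^bsub>H\<^esub> v [^]\<^bsub>H\<^esub> j) \<otimes>\<^bsub>H\<^esub>
        (case q of (i::nat, j::nat) \<Rightarrow> u [^]\<^bsub>H\<^esub> i \<otimes>\<^bsub>H\<^esub> v [^]\<^bsub>H\<^esub> j) =
      (case ?m p q of (i::nat, j::nat) \<Rightarrow> u [^]\<^bsub>H\<^esub> i \<otimes>\<^bsub>H\<^esub> v [^]\<^bsub>H\<^esub> j)" for p q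
      using H.normal_form_mult[OF u(1,2,5)] by (simp add: split_beta)
  qed
qed

lemma group_of_order_6:
  assumes "group G" "order G = 6"
  shows "G \<cong> integer_mod_group 6 \<or> G \<cong> sym_group 3"
proof (cases "comm_group G")
  case True
  have "order (integer_mod_group 6) = 6" by (simp add: order_def carrier_integer_mod_group)
  with True show ?thesis using order_6_iso[OF assms(1) group_integer_mod_group assms(2)] by simp
next
  case False
  have "order (sym_group 3) = 6"
    using card_permutations[of "{1..3::nat}" 3] by (simp add: order_def sym_group_def fact_numeral)
  moreover have "\<not> comm_group (sym_group 3)"
  proof
    \<comment> \<open>The two composites of these transpositions send 1 to 2 and to 3
      respectively.\<close>
    let ?s = "Transposition.transpose 1 (2::nat)" and ?t = "Transposition.transpose 2 (3::nat)"
    assume "comm_group (sym_group 3)"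
    moreover have "?s \<in> carrier (sym_group 3)" "?t \<in> carrier (sym_group 3)"
      by (simp_all add: sym_group_def permutes_swap_id)
    ultimately have "?s \<circ> ?t = ?t \<circ> ?s"
      using comm_monoid.m_comm[of "sym_group 3" ?s ?t] by (simp add: comm_group_def sym_group_def)
    then have "(?s \<circ> ?t) 1 = (?t \<circ> ?s) 1" by (rule fun_cong)
    then show False by (simp add: Transposition.transpose_def)
  qed
  ultimately show ?thesis
    using False order_6_iso[OF assms(1) sym_group_is_group assms(2)] by simp
qed

section \<open>The part of the stabiliser inside S3 x S3\<close>

text \<open>Moving the inverse to the other side leaves an equation linear in the entries of
  \<open>A\<close>.\<close>

lemma stabilizer_iff:
  fixes A :: "('n::nontriv) matZ"
  assumes "A \<in> frakF"
  shows "((\<sigma>, \<tau>), 0) \<in> stabilizer W W_action A \<longleftrightarrow>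
    \<sigma> permutes {1..3} \<and> \<tau> permutes {1..3} \<and> permM \<tau> ** A = A ** permM \<sigma>"
proof -
  have "permM \<tau> ** A ** matrix_inv (permM \<sigma>) = A \<longleftrightarrow> permM \<tau> ** A = A ** permM \<sigma>"
    if "\<sigma> permutes {1..3}"
    using matrix_inv_mult[OF permM_invertible[OF that, where ?'n = 'n]]
    by (metis matrix_mul_assoc matrix_mul_rid)
  then show ?thesis
    using assms by (auto simp: stabilizer_def W_carrier_iff W_action_def)
qed

lemma permM_eqD:
  assumes "(permM \<sigma> :: ('n::nontriv) matZ) = permM \<tau>" "\<sigma> permutes {1..3}" "\<tau> permutes {1..3}"
  shows "\<sigma> = \<tau>"
  using inj_onD[OF permM_inj, of \<sigma> \<tau>, OF assms(1)] assms(2,3) by (simp add: sym_group_carrier)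

text \<open>\<open>A\<close> is invertible and cancels from the intertwining equation;
  \<open>permM\<close> is injective.\<close>

lemma stabilizer_snd_unique:
  fixes A :: "('n::nontriv) matZ"
  assumes A: "A \<in> frakF"
    and st: "((\<sigma>, \<tau>), 0) \<in> stabilizer W W_action A" "((\<sigma>, \<tau>'), 0) \<in> stabilizer W W_action A"
  shows "\<tau> = \<tau>'"
proof (rule permM_eqD)
  have "permM \<tau> ** A = permM \<tau>' ** A" using st by (simp add: stabilizer_iff[OF A])
  then have "permM \<tau> ** (A ** matrix_inv A) = permM \<tau>' ** (A ** matrix_inv A)"
    by (simp add: matrix_mul_assoc)
  then show "(permM \<tau> :: 'n matZ) = permM \<tau>'"
    by (simp add: matrix_inv_mult frakF_invertible[OF A])
qed (use st in \<open>simp_all add: stabilizer_iff[OF A]\<close>)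

lemma stabilizer_fst_unique:
  fixes A :: "('n::nontriv) matZ"
  assumes A: "A \<in> frakF"
    and st: "((\<sigma>, \<tau>), 0) \<in> stabilizer W W_action A" "((\<sigma>', \<tau>), 0) \<in> stabilizer W W_action A"
  shows "\<sigma> = \<sigma>'"
proof (rule permM_eqD)
  have "A ** permM \<sigma> = A ** permM \<sigma>'" using st by (simp add: stabilizer_iff[OF A])
  then have "matrix_inv A ** A ** permM \<sigma> = matrix_inv A ** A ** permM \<sigma>'"
    by (simp flip: matrix_mul_assoc)
  then show "(permM \<sigma> :: 'n matZ) = permM \<sigma>'"
    by (simp add: matrix_inv_mult frakF_invertible[OF A])
qed (use st in \<open>simp_all add: stabilizer_iff[OF A]\<close>)

lemma subgroup_stabilizer_W:
  "(A :: ('n::nontriv) matZ) \<in> frakF \<Longrightarrow> subgroup (stabilizer W W_action A) W"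
  by (rule group_action.stabilizer_subgroup[OF group_action_W])

lemma permutes_3_eqI:
  assumes "\<sigma> permutes {1..3::nat}" "\<tau> permutes {1..3}" "\<sigma> 1 = \<tau> 1" "\<sigma> 2 = \<tau> 2" "\<sigma> 3 = \<tau> 3"
  shows "\<sigma> = \<tau>"
proof
  fix x :: nat
  consider "x = 1" | "x = 2" | "x = 3" | "x \<notin> {1..3}" unfolding atLeastAtMost_iff by linarith
  then show "\<sigma> x = \<tau> x" using assms by cases (auto simp: permutes_def)
qed

text \<open>
  A matrix intertwining two transpositions maps the fixed line of the first, spanned by
  \<open>(1, 0)\<close>, \<open>(0, 1)\<close> or \<open>(1, 1)\<close>, into that of the second; in each of the nine cases this
  makes one of the units in the definition of \<open>frakF\<close> vanish.
\<close>

lemma stabilizer_no_involution: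
  fixes A :: "('n::nontriv) matZ"
  assumes A: "A \<in> frakF" and st: "((\<sigma>, \<tau>), 0) \<in> stabilizer W W_action A" and inv: "\<sigma> \<circ> \<sigma> = id"
  shows "\<sigma> = id"
proof (rule ccontr)
  assume neq: "\<sigma> \<noteq> id"
  interpret S: subgroup "stabilizer W W_action A" W by (rule subgroup_stabilizer_W[OF A])
  have one: "((id, id), 0) \<in> stabilizer W W_action A"
    using S.one_closed by (simp add: W_one)
  have "((\<sigma> \<circ> \<sigma>, \<tau> \<circ> \<tau>), 0) \<in> stabilizer W W_action A"
    using S.m_closed[OF st st] by (simp add: W_mult)
  \<comment> \<open>Uniqueness of the second component carries the involution property from \<sigma>
    to \<tau>, and below uniqueness of the first carries non-triviality.\<close>
  then have inv': "\<tau> \<circ> \<tau> = id"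
    using stabilizer_snd_unique[OF A _ one] inv by simp
  have neq': "\<tau> \<noteq> id"
    using stabilizer_fst_unique[OF A st] one neq by blast
  have p: "\<sigma> permutes {1..3}" "\<tau> permutes {1..3}" and eq: "permM \<tau> ** A = A ** permM \<sigma>"
    using st by (simp_all add: stabilizer_iff[OF A])
  have transp: "(\<rho> 1 = 1 \<and> \<rho> 2 = 3) \<or> (\<rho> 1 = 2 \<and> \<rho> 2 = 1) \<or> (\<rho> 1 = 3 \<and> \<rho> 2 = 2)"
    if \<rho>: "\<rho> permutes {1..3::nat}" "\<rho> \<circ> \<rho> = id" "\<rho> \<noteq> id" for \<rho>
  proof -
    have "\<rho> (\<rho> 1) = 1" using fun_cong[OF \<rho>(2), of 1] by simp
    moreover have "\<not> (\<rho> 1 = 1 \<and> \<rho> 2 = 2 \<and> \<rho> 3 = 3)"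
      using permutes_3_eqI[OF \<rho>(1) permutes_id] \<rho>(3) by auto
    ultimately show ?thesis using permutes_3_cases[OF \<rho>(1)] by auto
  qed
  obtain a b c d where abcd: "A = mat2 a b c d" using mat2_eta by blast
  have z: "x \<noteq> 0" if "x dvd 1" for x :: "'n mod_ring" using that by auto
  note u = frakF_units[OF A[unfolded abcd]]
  have nz: "a \<noteq> 0" "b \<noteq> 0" "c \<noteq> 0" "d \<noteq> 0" "a + b \<noteq> 0" "c + d \<noteq> 0" "a \<noteq> c" "b \<noteq> d" "a + b \<noteq> c + d"
    using u(1-7,9,11)[THEN z] by auto
  from eq have e: "(permM \<tau> ** A) $ i $ j = (A ** permM \<sigma>) $ i $ j" for i j by simp
  from transp[OF p(1) inv neq] show False
  proof (elim disjE conjE)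
    assume "\<sigma> 1 = 1" "\<sigma> 2 = 3"
    with e[of 1 1] e[of 2 1] transp[OF p(2) inv' neq'] nz show False
      by (auto simp: permM_def abcd mat2_mult)
  next
    assume "\<sigma> 1 = 3" "\<sigma> 2 = 2"
    with e[of 1 2] e[of 2 2] transp[OF p(2) inv' neq'] nz show False
      by (auto simp: permM_def abcd mat2_mult)
  next
    \<comment> \<open>Here \<open>permM \<sigma>\<close> exchanges the basis vectors, so the first
      column of the equation says that \<open>permM \<tau>\<close> maps (a, c) to (b, d). This
      forces c + d = 0, a + b = c + d or a + b = 0, depending on \<tau>.\<close>
    assume "\<sigma> 1 = 2" "\<sigma> 2 = 1"
    with e[of 1 1] e[of 2 1] transp[OF p(2) inv' neq'] nz show False
      by (auto simp: permM_def abcd mat2_mult add.commute)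
  qed
qed

text \<open>"Even" refers to the exponent of J. Projection to the first component is injective on
  this part, and its image \<open>T\<close> is closed under composition and consists of
  rotations.\<close>

lemma stabilizer_even_part_card:
  fixes A :: "('n::nontriv) matZ"
  assumes A: "A \<in> frakF"
  shows "card {w \<in> stabilizer W W_action A. snd w = 0} \<in> {1, 3}" (is "card ?K \<in> _")
proof -
  interpret S: subgroup "stabilizer W W_action A" W by (rule subgroup_stabilizer_W[OF A])
  define T where "T = (fst \<circ> fst) ` ?K"
  define c where "c = cycle_of_list [1, 2, 3::nat]"
  have T_iff: "\<sigma> \<in> T \<longleftrightarrow> (\<exists>\<tau>. ((\<sigma>, \<tau>), 0) \<in> stabilizer W W_action A)" for \<sigma>
    unfolding T_def by force
  have "inj_on (fst \<circ> fst) ?K"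
    by (auto simp: inj_on_def intro: stabilizer_snd_unique[OF A])
  then have card: "card ?K = card T" unfolding T_def by (rule card_image[symmetric])
  have id: "id \<in> T" using S.one_closed T_iff by (auto simp: W_one)
  have comp: "\<sigma> \<circ> \<rho> \<in> T" if "\<sigma> \<in> T" "\<rho> \<in> T" for \<sigma> \<rho>
  proof -
    from that obtain \<tau> \<upsilon> where "((\<sigma>, \<tau>), 0) \<in> stabilizer W W_action A"
      "((\<rho>, \<upsilon>), 0) \<in> stabilizer W W_action A"
      unfolding T_iff by blast
    from S.m_closed[OF this] show ?thesis unfolding T_iff by (auto simp: W_mult)
  qed
  have c: "c permutes {1..3}" "c 1 = 2" "c 2 = 3" "c 3 = 1"
    unfolding c_def by (auto intro!: permutes_compose permutes_swap_id simp: Transposition.transpose_def)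
  have cc: "c \<circ> c permutes {1..3}" using c(1) c(1) by (rule permutes_compose)
  \<comment> \<open>As c has order 3, its square squares back to c; so closure of \<open>T\<close>
    under composition alone gives both or neither of the non-trivial rotations.\<close>
  have c4: "(c \<circ> c) \<circ> (c \<circ> c) = c"
    using c by (intro permutes_3_eqI permutes_compose cc) simp_all
  have T_sub: "T \<subseteq> {id, c, c \<circ> c}"
  proof
    fix \<sigma> assume "\<sigma> \<in> T"
    then obtain \<tau> where st: "((\<sigma>, \<tau>), 0) \<in> stabilizer W W_action A" using T_iff by blast
    then have p: "\<sigma> permutes {1..3}" by (simp add: stabilizer_iff[OF A])
    \<comment> \<open>This removes the three transpositions from the six cases for \<sigma>.\<close>
    have "\<sigma> = id" if "\<sigma> (\<sigma> 1) = 1" "\<sigma> (\<sigma> 2) = 2" "\<sigma> (\<sigma> 3) = 3"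
      using that p
      by (intro stabilizer_no_involution[OF A st] permutes_3_eqI permutes_compose permutes_id) simp_all
    then have "\<sigma> = id \<or> (\<sigma> 1 = c 1 \<and> \<sigma> 2 = c 2 \<and> \<sigma> 3 = c 3) \<or>
        (\<sigma> 1 = (c \<circ> c) 1 \<and> \<sigma> 2 = (c \<circ> c) 2 \<and> \<sigma> 3 = (c \<circ> c) 3)"
      using permutes_3_cases[OF p] c by (elim disjE conjE) simp_all
    then show "\<sigma> \<in> {id, c, c \<circ> c}"
      using permutes_3_eqI[OF p c(1)] permutes_3_eqI[OF p cc] by blast
  qed
  have "c \<in> T \<longleftrightarrow> c \<circ> c \<in> T" using comp c4 by metis
  then have "T = {id} \<or> T = {id, c, c \<circ> c}" using T_sub id by blast
  moreover have "id \<noteq> c" "id \<noteq> c \<circ> c" "c \<noteq> c \<circ> c"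
    using c by (auto dest: fun_cong[of _ _ 1])
  ultimately show ?thesis unfolding card by auto
qed

section \<open>Order of the stabiliser and the final classification\<close>

text \<open>If some element \<open>h\<close> of the stabiliser involves J, right multiplication by
  \<open>h\<close> exchanges the elements with and without J, so the two halves are equally large;
  otherwise only \<open>K\<close> remains.\<close>

lemma stabilizer_card:
  fixes A :: "('n::nontriv) matZ"
  assumes A: "A \<in> frakF"
  shows "card (stabilizer W W_action A) \<in> {1, 2, 3, 6}" (is "card ?S \<in> _")
proof -
  interpret W: group W by (rule group_W)
  interpret S: subgroup ?S W by (rule subgroup_stabilizer_W[OF A])
  define K where "K = {w \<in> ?S. snd w = 0}"
  define L where "L = {w \<in> ?S. snd w = 1}"
  have snd: "snd w = 0 \<or> snd w = 1" if "w \<in> ?S" for w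
    using S.mem_carrier[OF that] by (cases w rule: prod.exhaust, cases "fst w") (auto simp: W_carrier_iff)
  have snd_mult: "snd (v \<otimes>\<^bsub>W\<^esub> w) = (snd v + snd w) mod 2" for v w
    by (cases v rule: prod.exhaust, cases w rule: prod.exhaust, cases "fst v", cases "fst w")
      (auto simp: W_mult)
  have "finite (carrier W)"
    by (simp add: W_def semidirect_product_def sym_group_def DirProd_def finite_permutations
        carrier_integer_mod_group)
  then have "finite ?S" by (rule finite_subset[OF S.subset])
  moreover have "?S = K \<union> L" "K \<inter> L = {}" using snd unfolding K_def L_def by auto
  ultimately have fin: "finite K" "finite L" and card: "card ?S = card K + card L"
    by (simp_all add: card_Un_disjoint)
  \<comment> \<open>Both inequalities come from the same injective map: multiplication by
    \<open>h\<close> adds 1 modulo 2 to the exponent of J.\<close>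
  have "card K = card L" if "h \<in> L" for h
  proof (rule antisym)
    have inj: "inj_on (\<lambda>w. w \<otimes>\<^bsub>W\<^esub> h) ?S"
      using that unfolding L_def by (auto simp: inj_on_def)
    have sub: "(\<lambda>w. w \<otimes>\<^bsub>W\<^esub> h) ` K \<subseteq> L" "(\<lambda>w. w \<otimes>\<^bsub>W\<^esub> h) ` L \<subseteq> K"
      using that unfolding K_def L_def by (auto simp: snd_mult)
    show "card K \<le> card L" "card L \<le> card K"
      using card_inj_on_le[OF inj_on_subset[OF inj] sub(1) fin(2)]
        card_inj_on_le[OF inj_on_subset[OF inj] sub(2) fin(1)]
      unfolding K_def L_def by auto
  qed
  then have "card ?S = card K \<or> card ?S = 2 * card K"
    using card by (cases "L = {}") auto
  then show ?thesis using stabilizer_even_part_card[OF A] unfolding K_def by auto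
qed

theorem proposition1:
  fixes A :: "('n::nontriv) matZ"
  assumes "CARD('n) \<ge> 5"
    and "A \<in> frakF"
  shows "let H = W\<lparr>carrier := stabilizer W W_action A\<rparr> in
           H \<cong> singleton_group () \<or> H \<cong> integer_mod_group 2 \<or> H \<cong> integer_mod_group 3 \<or>
           H \<cong> integer_mod_group 6 \<or> H \<cong> sym_group 3"
proof -
  define H where "H = W\<lparr>carrier := stabilizer W W_action A\<rparr>"
  interpret H: group H
    unfolding H_def
    by (rule subgroup.subgroup_is_group[OF subgroup_stabilizer_W[OF assms(2)] group_W])
  consider "order H = 1" | "order H = 2" | "order H = 3" | "order H = 6"
    using stabilizer_card[OF assms(2)] by (auto simp: H_def order_def)
  then have "H \<cong> singleton_group () \<or> H \<cong> integer_mod_group 2 \<or> H \<cong> integer_mod_group 3 \<or>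
      H \<cong> integer_mod_group 6 \<or> H \<cong> sym_group 3"
  proof cases
    case 1
    then obtain x where "carrier H = {x}" by (auto simp: order_def card_1_singleton_iff)
    then have "(\<lambda>_. ()) \<in> iso H (singleton_group ())"
      by (intro isoI) (simp_all add: hom_def singleton_group_def bij_betw_def)
    then show ?thesis by (intro disjI1 is_isoI)
  next
    case 2
    then show ?thesis using H.iso_integer_mod_group_of_prime_order by simp
  next
    case 3
    then show ?thesis using H.iso_integer_mod_group_of_prime_order by simp
  next
    case 4
    then show ?thesis using group_of_order_6[OF H.is_group] by simp
  qed
  then show ?thesis by (simp add: H_def Let_def)
qed

end
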